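(* Let $\lambda$ be a nonzero real number. For every integer $n\ge 0$, $$\sum_{l=0}^{n}F_{l,\lambda}(1)S_{1,\lambda}(n,l)=\sum_{l=0}^{n}\binom{n}{l}d_{l,\lambda}(1)_{n-l,\lambda}=\sum_{l=0}^{n}\binom{n}{l}d_{l,\lambda}(x)(1-x)_{n-l,\lambda}.$$
   Context: For a nonzero real $\lambda$, the degenerate falling factorial is $(x)_{0,\lambda}=1$ and $(x)_{n,\lambda}=x(x-\lambda)\cdots(x-(n-1)\lambda)$ for $n\ge1$. The degenerate exponential function is $e_{\lambda}^{x}(t)=(1+\lambda t)^{x/\lambda}=\sum_{n\ge0}(x)_{n,\lambda}\frac{t^n}{n!}$, $e_\lambda(t)=e_\lambda^1(t)$, and $\log_\lambda(t)=\frac{t^\lambda-1}{\lambda}$ is the compositional inverse of $e_\lambda(t)$. The degenerate derangement polynomials $d_{n,\lambda}(x)$ are defined by $\frac{1}{1-t}e_{\lambda}^{x-1}(t)=\sum_{n\ge0}d_{n,\lambda}(x)\frac{t^n}{n!}$, and $d_{n,\lambda}=d_{n,\lambda}(0)$. The degenerate Fubini polynomials $F_{n,\lambda}(y)$ are defined by $\frac{1}{1-y(e_{\lambda}(t)-1)}=\sum_{n\ge0}F_{n,\lambda}(y)\frac{t^n}{n!}$. The degenerate Stirling numbers of the first kind $S_{1,\lambda}(n,m)$ are defined by $\frac{1}{m!}(\log_\lambda(1+t))^m=\sum_{n\ge m}S_{1,\lambda}(n,m)\frac{t^n}{n!}$ for $m\ge0$. *)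

theory Defs
  imports "HOL-Computational_Algebra.Computational_Algebra"
begin

definition dfall :: "real \<Rightarrow> real \<Rightarrow> nat \<Rightarrow> real" where
  "dfall lam x n = (\<Prod>i<n. x - real i * lam)"

text \<open>
  Generating functions are formal power series over the reals in \<open>t = fps_X\<close>.
  As \<open>fps_binomial c\<close> is \<open>(1 + t)\<close> to the power \<open>c\<close>, the series below is
  \<open>(1 + lam t)\<close> to the power \<open>x / lam\<close>. It is meaningful for \<open>lam \<noteq> 0\<close>.
\<close>
definition dexp :: "real \<Rightarrow> real \<Rightarrow> real fps" where
  "dexp lam x = fps_binomial (x / lam) oo (fps_const lam * fps_X)"

lemma fps_nth_dexp:
  assumes "lam \<noteq> 0"
  shows "fps_nth (dexp lam x) n = dfall lam x n / fact n"
proof -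
  have "lam ^ n * (\<Prod>i<n. x / lam - real i) = (\<Prod>i<n. lam * (x / lam - real i))"
    by (simp add: prod.distrib)
  also have "\<dots> = dfall lam x n"
    unfolding dfall_def using assms by (intro prod.cong) (auto simp: field_simps)
  finally show ?thesis
    by (simp add: dexp_def gbinomial_prod_rev atLeast0LessThan)
qed

text \<open>
  The degenerate logarithm of \<open>t\<close> is \<open>(t powr lam - 1) / lam\<close>. The series below expands it
  at \<open>1 + t\<close>, that is, at the shifted argument.
\<close>
definition dlog1p :: "real \<Rightarrow> real fps" where
  "dlog1p lam = fps_const (1 / lam) * (fps_binomial lam - 1)"

definition dderange :: "real \<Rightarrow> nat \<Rightarrow> real \<Rightarrow> real" where
  "dderange lam n x = fact n * fps_nth (inverse (1 - fps_X) * dexp lam (x - 1)) n"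

definition dderange_num :: "real \<Rightarrow> nat \<Rightarrow> real" where
  "dderange_num lam n = dderange lam n 0"

definition dfubini :: "real \<Rightarrow> nat \<Rightarrow> real \<Rightarrow> real" where
  "dfubini lam n y = fact n * fps_nth (inverse (1 - fps_const y * (dexp lam 1 - 1))) n"

definition dstirling1 :: "real \<Rightarrow> nat \<Rightarrow> nat \<Rightarrow> real" where
  "dstirling1 lam n m = fact n * fps_nth (fps_const (1 / fact m) * dlog1p lam ^ m) n"

lemma dstirling1_eq_0:
  assumes "n < m"
  shows "dstirling1 lam n m = 0"
proof -
  have "fps_nth (dlog1p lam) 0 = 0"
    by (simp add: dlog1p_def)
  then have "fps_nth (dlog1p lam ^ m) n = 0"
    using assms startsby_zero_power_prefix by blast
  then show ?thesis
    by (simp add: dstirling1_def)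
qed

end

theory Submission
  imports Defs
begin

text \<open>
  All three sums equal \<open>fact n\<close>. The second and third are binomial convolutions, with exponential
  generating function \<open>inverse (1 - t) * dexp lam (y - 1) * dexp lam (1 - y)\<close> for \<open>y = 0\<close> and
  \<open>y = x\<close>; the exponential factors cancel. The first has as exponential generating function
  the Fubini series composed with \<open>dlog1p lam\<close>, and since \<open>dlog1p lam\<close> inverts
  \<open>dexp lam 1 - 1\<close> under composition, this is again \<open>inverse (1 - t)\<close>.
\<close>

text \<open>The formal law \<open>((1 + t)^d)^c = (1 + t)^(c * d)\<close>: the composite has
  constant term 1 and satisfies the differential equation that characterises the binomial series
  with exponent \<open>c * d\<close>.\<close>

lemma fps_binomial_compose:
  "fps_binomial c oo (fps_binomial d - 1) = fps_binomial (c * d :: 'a :: field_char_0)"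
proof -
  let ?g = "fps_binomial d - 1 :: 'a fps"
  let ?h = "fps_binomial c oo ?g"
  have g0: "?g $ 0 = 0"
    by simp
  have shift: "(1 + fps_X) oo ?g = fps_binomial d"
    using g0 by (simp add: fps_compose_add_distrib)
  have "fps_deriv (fps_binomial c) * (1 + fps_X) = fps_const c * fps_binomial c"
    by (simp add: fps_binomial_deriv fps_divide_unit inverse_mult_eq_1 mult.assoc)
  \<comment> \<open>Substituting \<open>?g\<close> into the equation of the outer series turns its
    factor \<open>1 + fps_X\<close> into \<open>fps_binomial d\<close>, the factor that
    \<open>fps_deriv ?g\<close> supplies below.\<close>
  from arg_cong[OF this, of "\<lambda>f. f oo ?g"]
  have chain: "(fps_deriv (fps_binomial c) oo ?g) * fps_binomial d = fps_const c * ?h"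
    by (simp only: fps_compose_mult_distrib[OF g0] shift fps_const_compose)
  have "fps_deriv ?h = (fps_deriv (fps_binomial c) oo ?g) * fps_deriv ?g"
    by (rule fps_compose_deriv[OF g0])
  also have "\<dots> = (fps_deriv (fps_binomial c) oo ?g) * fps_binomial d * (fps_const d / (1 + fps_X))"
    by (simp add: fps_binomial_deriv fps_divide_unit mult_ac)
  also have "\<dots> = fps_const (c * d) * ?h / (1 + fps_X)"
    unfolding chain by (simp add: fps_divide_unit mult_ac flip: fps_const_mult)
  finally show ?thesis
    using fps_binomial_ODE_unique'[of ?h "c * d"] by simp
qed

lemma dexp_0 [simp]: "dexp lam 0 = 1"
  by (simp add: dexp_def)

lemma dexp_add: "dexp lam (x + y) = dexp lam x * dexp lam y"
  by (simp add: dexp_def add_divide_distrib fps_binomial_add_mult fps_compose_mult_distrib)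

lemma dlog1p_nth_0 [simp]: "dlog1p lam $ 0 = 0"
  by (simp add: dlog1p_def)

text \<open>Scaling \<open>dlog1p lam\<close> by \<open>lam\<close> leaves
  \<open>fps_binomial lam - 1\<close>, so the composite is \<open>(1 + t)^lam\<close> raised to the
  power \<open>1 / lam\<close>.\<close>

lemma dexp_compose_dlog1p:
  assumes "lam \<noteq> 0"
  shows "dexp lam 1 oo dlog1p lam = 1 + fps_X"
proof -
  have "dexp lam 1 oo dlog1p lam = fps_binomial (1 / lam) oo (fps_const lam * fps_X oo dlog1p lam)"
    by (simp add: dexp_def fps_compose_assoc)
  also have "fps_const lam * fps_X oo dlog1p lam = fps_const lam * dlog1p lam"
    by (simp add: fps_compose_mult_distrib)
  also have "\<dots> = fps_binomial lam - 1"
    using assms by (simp add: dlog1p_def flip: mult.assoc)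
  also have "fps_binomial (1 / lam) oo \<dots> = 1 + fps_X"
    using assms by (simp add: fps_binomial_compose fps_binomial_1)
  finally show ?thesis .
qed

lemma fps_nth_inverse_one_minus_fps_X:
  "inverse (1 - fps_X :: 'a :: field fps) $ n = 1"
proof -
  have "inverse (1 - fps_X :: 'a fps) = Abs_fps (\<lambda>_. 1)"
    unfolding fps_inverse_gp'[symmetric] by (rule fps_inverse_idempotent) simp
  then show ?thesis
    by simp
qed

lemma sum_dfubini_dstirling1:
  assumes "lam \<noteq> 0"
  shows "(\<Sum>l=0..n. dfubini lam l 1 * dstirling1 lam n l) = fact n"
proof -
  let ?f = "inverse (1 - (dexp lam 1 - 1))"
  have "(\<Sum>l=0..n. dfubini lam l 1 * dstirling1 lam n l)
      = (\<Sum>l=0..n. fact n * (?f $ l * dlog1p lam ^ l $ n))"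
    \<comment> \<open>The \<open>fact l\<close> of the Fubini number cancels the
      \<open>1 / fact l\<close> of the Stirling number.\<close>
    by (intro sum.cong) (simp_all add: dfubini_def dstirling1_def)
  also have "\<dots> = fact n * (?f oo dlog1p lam) $ n"
    by (simp add: fps_compose_nth sum_distrib_left)
  also have "?f oo dlog1p lam = inverse (1 - (dexp lam 1 - 1) oo dlog1p lam)"
    \<comment> \<open>The series being inverted has constant term 1, and \<open>dlog1p lam\<close>
      has constant term 0.\<close>
    by (intro fps_inverse_compose) (simp_all add: dexp_def)
  also have "1 - (dexp lam 1 - 1) oo dlog1p lam = 1 - fps_X"
    using assms by (simp add: fps_compose_sub_distrib dexp_compose_dlog1p)
  finally show ?thesis
    by (simp add: fps_nth_inverse_one_minus_fps_X)
qed

lemma sum_dderange_dfall: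
  assumes "lam \<noteq> 0"
  shows "(\<Sum>l=0..n. real (n choose l) * dderange lam l x * dfall lam (1 - x) (n - l)) = fact n"
proof -
  let ?d = "inverse (1 - fps_X) * dexp lam (x - 1)"
  have "(\<Sum>l=0..n. real (n choose l) * dderange lam l x * dfall lam (1 - x) (n - l))
      = (\<Sum>l=0..n. fact n * (?d $ l * dexp lam (1 - x) $ (n - l)))"
    using assms by (intro sum.cong) (simp_all add: dderange_def fps_nth_dexp binomial_fact)
  also have "\<dots> = fact n * (?d * dexp lam (1 - x)) $ n"
    by (simp add: fps_mult_nth sum_distrib_left)
  also have "?d * dexp lam (1 - x) = inverse (1 - fps_X)"
    by (simp add: mult.assoc flip: dexp_add)
  finally show ?thesis
    by (simp add: fps_nth_inverse_one_minus_fps_X)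
qed

theorem theorem5:
  fixes lam x :: real and n :: nat
  assumes "lam \<noteq> 0"
  shows "(\<Sum>l=0..n. dfubini lam l 1 * dstirling1 lam n l)
           = (\<Sum>l=0..n. real (n choose l) * dderange_num lam l * dfall lam 1 (n - l))
       \<and> (\<Sum>l=0..n. real (n choose l) * dderange_num lam l * dfall lam 1 (n - l))
           = (\<Sum>l=0..n. real (n choose l) * dderange lam l x * dfall lam (1 - x) (n - l))"
  \<comment> \<open>The middle sum is the derangement convolution at \<open>x = 0\<close>, where
    \<open>1 - x\<close> becomes 1.\<close>
  using sum_dfubini_dstirling1[OF assms, of n] sum_dderange_dfall[OF assms, of n 0]
    sum_dderange_dfall[OF assms, of n x]
  by (simp add: dderange_num_def)

end
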